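(* For $n\ge1$ let $a(n,j)$ (resp. $\bar a(n,j)$) be the number of permutations in $\mathfrak{S}_n$ with $j$ descents at odd positions and no descents (resp. no ascents) at even positions, so that $A_n(x,0)=\sum_{j=0}^{\lfloor n/2\rfloor}a(n,j)x^j$ and $\widehat{A}_n(x,0)=\sum_{j=0}^{\lfloor n/2\rfloor}\bar a(n,j)x^j$. Then $$\widetilde{A}_n(x,y)=\sum_{j=0}^{\lfloor n/2\rfloor}a(n,j)\,(x+y)^j(1+xy)^{\lfloor n/2\rfloor-j},\qquad \overline{A}_n(x,y)=\sum_{j=0}^{\lfloor n/2\rfloor}\bar a(n,j)\,(x+y)^j(1+xy)^{\lfloor n/2\rfloor-j}.$$ Moreover, $\bar a(n,j)=a(n,\lfloor n/2\rfloor-j)$ for $0\le j\le\lfloor n/2\rfloor$.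
   Context: For $\sigma\in\mathfrak{S}_n$, a position $i\in[n-1]$ is a descent if $\sigma(i)>\sigma(i+1)$ and an ascent if $\sigma(i)<\sigma(i+1)$. $\mathrm{des}_1\sigma$ (resp. $\mathrm{des}_0\sigma$) is the number of descents at odd (resp. even) positions, and $\mathrm{asc}_0\sigma$ the number of ascents at even positions. $A_n(x,y)=\sum_{\sigma\in\mathfrak{S}_n}x^{\mathrm{des}_1\sigma}y^{\mathrm{des}_0\sigma}$ and $\widehat{A}_n(x,y)=\sum_{\sigma\in\mathfrak{S}_n}x^{\mathrm{des}_1\sigma}y^{\mathrm{asc}_0\sigma}$. For $m\ge1$: $\widetilde{A}_{2m}(x,y)=(1+y)A_{2m}(x,y)$, $\widetilde{A}_{2m-1}(x,y)=A_{2m-1}(x,y)$, $\overline{A}_{2m}(x,y)=(1+y)\widehat{A}_{2m}(x,y)$, $\overline{A}_{2m-1}(x,y)=\widehat{A}_{2m-1}(x,y)$. *)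

theory Defs
  imports Main "HOL-Combinatorics.Permutations"
begin

definition des1 :: "nat \<Rightarrow> (nat \<Rightarrow> nat) \<Rightarrow> nat" where
  "des1 n \<sigma> = card {i \<in> {1..<n}. odd i \<and> \<sigma> i > \<sigma> (i + 1)}"

definition des0 :: "nat \<Rightarrow> (nat \<Rightarrow> nat) \<Rightarrow> nat" where
  "des0 n \<sigma> = card {i \<in> {1..<n}. even i \<and> \<sigma> i > \<sigma> (i + 1)}"

definition asc0 :: "nat \<Rightarrow> (nat \<Rightarrow> nat) \<Rightarrow> nat" where
  "asc0 n \<sigma> = card {i \<in> {1..<n}. even i \<and> \<sigma> i < \<sigma> (i + 1)}"

text \<open>
  The bivariate polynomials are represented by their evaluations at points of an arbitrary
  commutative ring; taking the ring to be \<open>int poly poly\<close> and the two points to be its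
  indeterminates recovers identities of formal polynomials.
\<close>

definition A_poly :: "nat \<Rightarrow> 'a::comm_ring_1 \<Rightarrow> 'a \<Rightarrow> 'a" where
  "A_poly n x y = (\<Sum>\<sigma> | \<sigma> permutes {1..n}. x ^ des1 n \<sigma> * y ^ des0 n \<sigma>)"

definition A_hat :: "nat \<Rightarrow> 'a::comm_ring_1 \<Rightarrow> 'a \<Rightarrow> 'a" where
  "A_hat n x y = (\<Sum>\<sigma> | \<sigma> permutes {1..n}. x ^ des1 n \<sigma> * y ^ asc0 n \<sigma>)"

definition A_tilde :: "nat \<Rightarrow> 'a::comm_ring_1 \<Rightarrow> 'a \<Rightarrow> 'a" where
  "A_tilde n x y = (if even n then (1 + y) * A_poly n x y else A_poly n x y)"

definition A_bar :: "nat \<Rightarrow> 'a::comm_ring_1 \<Rightarrow> 'a \<Rightarrow> 'a" where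
  "A_bar n x y = (if even n then (1 + y) * A_hat n x y else A_hat n x y)"

definition a_num :: "nat \<Rightarrow> nat \<Rightarrow> nat" where
  "a_num n j = card {\<sigma>. \<sigma> permutes {1..n} \<and> des1 n \<sigma> = j \<and> des0 n \<sigma> = 0}"

definition a_bar_num :: "nat \<Rightarrow> nat \<Rightarrow> nat" where
  "a_bar_num n j = card {\<sigma>. \<sigma> permutes {1..n} \<and> des1 n \<sigma> = j \<and> asc0 n \<sigma> = 0}"

end

theory Submission
  imports Defs "HOL-Combinatorics.Multiset_Permutations" "HOL-Computational_Algebra.Polynomial"
begin

text \<open>
  Give the odd descents, odd ascents, even descents and even ascents of a permutation four
  independent weights $a, b, c, d$. Splitting a permutation at its maximum yields differential
  equations for the exponential generating functions over odd and even $n$. With $s = ad + bc$ and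
  $t = ac + bd$ their solution is $U$ for odd $n$ and $(a + b) V$ for even $n \ge 2$, where
  $U' = 1 + tV + sU^2$ and $V' = U + sUV$, thanks to the first integral $U^2 = 2V + (s + t) V^2$.
  Hence the coefficients of $U + (s + t) V$ are homogeneous polynomials in $s$ and $t$ of degree
  $\lfloor n/2 \rfloor$. The weights $(x, 1, y, 1)$ and $(x, 1, 1, y)$ give $(s, t) = (x + y, 1 + xy)$
  and $(s, t) = (1 + xy, x + y)$ respectively, and putting $y = 0$ identifies the coefficients.
\<close>

section \<open>Hurwitz series\<close>

text \<open>
  A Hurwitz series stands for the exponential generating function $\sum_n f_n u^n / n!$. Its product
  is the binomial convolution, so that no division by factorials is needed and the coefficients may
  come from any commutative ring.
\<close>

typedef 'a hurwitz = "UNIV :: (nat \<Rightarrow> 'a) set"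
  morphisms hnth Hurwitz by auto

setup_lifting type_definition_hurwitz

lemma hurwitz_eqI: "(\<And>n. hnth f n = hnth g n) \<Longrightarrow> f = g"
  by transfer auto

instantiation hurwitz :: (comm_ring_1) ab_group_add
begin

lift_definition zero_hurwitz :: "'a hurwitz" is "\<lambda>n. 0" .
lift_definition plus_hurwitz :: "'a hurwitz \<Rightarrow> 'a hurwitz \<Rightarrow> 'a hurwitz" is "\<lambda>f g n. f n + g n" .
lift_definition minus_hurwitz :: "'a hurwitz \<Rightarrow> 'a hurwitz \<Rightarrow> 'a hurwitz" is "\<lambda>f g n. f n - g n" .
lift_definition uminus_hurwitz :: "'a hurwitz \<Rightarrow> 'a hurwitz" is "\<lambda>f n. - f n" .

instance by standard (transfer; auto simp: algebra_simps)+

end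

lemma hnth_zero [simp]: "hnth 0 n = 0"
  by transfer simp

lemma hnth_add [simp]: "hnth (f + g) n = hnth f n + hnth g n"
  by transfer simp

lemma hnth_diff [simp]: "hnth (f - g) n = hnth f n - hnth g n"
  by transfer simp

lift_definition hderiv :: "'a hurwitz \<Rightarrow> 'a hurwitz" is "\<lambda>f n. f (Suc n)" .

lemma hnth_hderiv: "hnth (hderiv f) n = hnth f (Suc n)"
  by transfer simp

lemma hderiv_add [simp]: "hderiv (f + g) = hderiv f + hderiv (g :: 'a::comm_ring_1 hurwitz)"
  by (rule hurwitz_eqI) (simp add: hnth_hderiv)

lemma hderiv_diff [simp]: "hderiv (f - g) = hderiv f - hderiv (g :: 'a::comm_ring_1 hurwitz)"
  by (rule hurwitz_eqI) (simp add: hnth_hderiv)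

text \<open>The ring laws come later: the Leibniz rule needs only the additive group and then serves
  to prove them.\<close>

instantiation hurwitz :: (comm_ring_1) "{one, times}"
begin

lift_definition one_hurwitz :: "'a hurwitz" is "\<lambda>n. if n = 0 then 1 else 0" .
lift_definition times_hurwitz :: "'a hurwitz \<Rightarrow> 'a hurwitz \<Rightarrow> 'a hurwitz"
  is "\<lambda>f g n. \<Sum>k\<le>n. of_nat (n choose k) * f k * g (n - k)" .

instance ..

end

lemma hnth_one: "hnth 1 n = (if n = 0 then 1 else 0)"
  by transfer simp

lemma hnth_mult:
  "hnth (f * g) n = (\<Sum>k\<le>n. of_nat (n choose k) * hnth f k * hnth g (n - k))"
  by transfer simp

text \<open>Pascal's rule splits \<open>Suc n choose Suc k\<close> into the binomials of the two
  summands.\<close>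

lemma hderiv_mult [simp]: "hderiv (f * g) = hderiv f * g + f * hderiv (g :: 'a::comm_ring_1 hurwitz)"
proof (rule hurwitz_eqI)
  fix n
  have "hnth (hderiv (f * g)) n
      = hnth f 0 * hnth g (Suc n)
        + (\<Sum>k\<le>n. of_nat (n choose Suc k) * hnth f (Suc k) * hnth g (n - k))
        + hnth (hderiv f * g) n"
    by (simp add: hnth_hderiv hnth_mult sum.atMost_Suc_shift sum.distrib algebra_simps
        del: sum.atMost_Suc)
  also have "hnth f 0 * hnth g (Suc n)
        + (\<Sum>k\<le>n. of_nat (n choose Suc k) * hnth f (Suc k) * hnth g (n - k))
      = (\<Sum>k\<le>Suc n. of_nat (n choose k) * hnth f k * hnth g (Suc n - k))"
    by (subst sum.atMost_Suc_shift) simp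
  \<comment> \<open>The additional term \<open>k = Suc n\<close> carries
    \<open>n choose Suc n\<close>, which is 0.\<close>
  also have "\<dots> = hnth (f * hderiv g) n"
    by (simp add: hnth_mult hnth_hderiv Suc_diff_le binomial_eq_0)
  finally show "hnth (hderiv (f * g)) n = hnth (hderiv f * g + f * hderiv g) n"
    by (simp add: add.commute)
qed

lemma hnth_mult_0 [simp]: "hnth (f * g) 0 = hnth f 0 * hnth g 0"
  by (simp add: hnth_mult)

lemma hnth_mult_Suc:
  "hnth (f * g) (Suc n) = hnth (hderiv f * g) n + hnth (f * hderiv (g :: 'a::comm_ring_1 hurwitz)) n"
  by (metis hderiv_mult hnth_add hnth_hderiv)

instance hurwitz :: (comm_ring_1) comm_ring_1
proof
  fix f g h :: "'a hurwitz"
  have distr: "(f + g) * h = f * h + g * h" for f g h :: "'a hurwitz"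
    by (rule hurwitz_eqI) (simp add: hnth_mult sum.distrib algebra_simps)
  have distl: "f * (g + h) = f * g + f * h" for f g h :: "'a hurwitz"
    by (rule hurwitz_eqI) (simp add: hnth_mult sum.distrib algebra_simps)
  show "(f + g) * h = f * h + g * h" by (rule distr)
  show "f * g = g * f"
  proof (rule hurwitz_eqI)
    \<comment> \<open>The Leibniz rule expresses coefficient \<open>Suc n\<close> of a product
      through coefficients \<open>n\<close> of products with one factor differentiated. Induction
      over all factors at once thus replaces binomial identities, here and for
      associativity.\<close>
    show "hnth (f * g) n = hnth (g * f) n" for n
      by (induction n arbitrary: f g) (simp_all add: hnth_mult_Suc mult.commute add.commute)
  qed
  show "f * g * h = f * (g * h)"
  proof (rule hurwitz_eqI)
    show "hnth (f * g * h) n = hnth (f * (g * h)) n" for n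
      by (induction n arbitrary: f g h)
         (simp_all add: hnth_mult_Suc distr distl mult.assoc add.assoc)
  qed
  show "1 * f = f"
  proof (rule hurwitz_eqI)
    fix n
    have "hnth (1 * f) n
        = (\<Sum>k\<le>n. if k = 0 then of_nat (n choose k) * hnth f (n - k) else 0)"
      unfolding hnth_mult by (rule sum.cong) (auto simp: hnth_one)
    then show "hnth (1 * f) n = hnth f n" by simp
  qed
  show "(0 :: 'a hurwitz) \<noteq> 1"
    by (metis hnth_one hnth_zero zero_neq_one)
qed

lift_definition hconst :: "'a::comm_ring_1 \<Rightarrow> 'a hurwitz" is "\<lambda>c n. if n = 0 then c else 0" .

lemma hnth_hconst: "hnth (hconst c) n = (if n = 0 then c else 0)"
  by transfer simp

lemma hnth_hconst_mult [simp]: "hnth (hconst c * f) n = c * hnth f n"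
proof -
  have "hnth (hconst c * f) n
      = (\<Sum>k\<le>n. if k = 0 then of_nat (n choose k) * c * hnth f (n - k) else 0)"
    unfolding hnth_mult by (rule sum.cong) (auto simp: hnth_hconst)
  then show ?thesis by simp
qed

lemma hderiv_hconst [simp]: "hderiv (hconst c) = 0"
  by (rule hurwitz_eqI) (simp add: hnth_hderiv hnth_hconst)

lemma hderiv_1 [simp]: "hderiv (1 :: 'a::comm_ring_1 hurwitz) = 0"
  by (rule hurwitz_eqI) (simp add: hnth_hderiv hnth_one)

lemma hconst_add: "hconst (a + b) = hconst a + hconst b"
  by (rule hurwitz_eqI) (simp add: hnth_hconst)

lemma hconst_mult: "hconst (a * b) = hconst a * hconst b"
  by (rule hurwitz_eqI) (simp add: hnth_hconst)

text \<open>Coefficient \<open>Suc m\<close> of \<open>f\<close> is a convolution of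
  \<open>g\<close> with the coefficients of \<open>f\<close> up to \<open>m\<close>, which vanish by
  induction.\<close>

lemma hurwitz_linear_ode_unique:
  fixes f g :: "'a::comm_ring_1 hurwitz"
  assumes ode: "hderiv f = g * f" and init: "hnth f 0 = 0"
  shows "f = 0"
proof (rule hurwitz_eqI)
  show "hnth f n = hnth 0 n" for n
  proof (induction n rule: less_induct)
    case (less n)
    show ?case
    proof (cases n)
      case (Suc m)
      then have "hnth f n = hnth (g * f) m"
        by (metis ode hnth_hderiv)
      also have "\<dots> = 0"
        using less Suc by (auto simp: hnth_mult intro!: sum.neutral)
      finally show ?thesis by simp
    qed (simp add: init)
  qed
qed

section \<open>The system of differential equations\<close>

text \<open>The system for U and V with zero initial values, unfolded coefficientwise; the
  \<open>if\<close> is the constant 1 in U'.\<close>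

fun odd_coeff even_coeff :: "'a::comm_ring_1 \<Rightarrow> 'a \<Rightarrow> nat \<Rightarrow> 'a" where
  "odd_coeff s t 0 = 0"
| "odd_coeff s t (Suc n) = (if n = 0 then 1 else 0) + t * even_coeff s t n
     + s * (\<Sum>k\<le>n. of_nat (n choose k) * odd_coeff s t k * odd_coeff s t (n - k))"
| "even_coeff s t 0 = 0"
| "even_coeff s t (Suc n) = odd_coeff s t n
     + s * (\<Sum>k\<le>n. of_nat (n choose k) * odd_coeff s t k * even_coeff s t (n - k))"

lift_definition odd_series :: "'a::comm_ring_1 \<Rightarrow> 'a \<Rightarrow> 'a hurwitz" is odd_coeff .
lift_definition even_series :: "'a::comm_ring_1 \<Rightarrow> 'a \<Rightarrow> 'a hurwitz" is even_coeff .

lemma hnth_odd_series [simp]: "hnth (odd_series s t) n = odd_coeff s t n"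
  by transfer simp

lemma hnth_even_series [simp]: "hnth (even_series s t) n = even_coeff s t n"
  by transfer simp

lemma hderiv_odd_series:
  "hderiv (odd_series s t)
    = 1 + hconst t * even_series s t + hconst s * (odd_series s t * odd_series s t)"
  by (rule hurwitz_eqI) (simp add: hnth_hderiv hnth_one hnth_mult[of "odd_series s t"])

lemma hderiv_even_series:
  "hderiv (even_series s t) = odd_series s t + hconst s * (odd_series s t * even_series s t)"
  by (rule hurwitz_eqI) (simp add: hnth_hderiv hnth_mult[of "odd_series s t"])

lemma odd_series_square:
  "odd_series s t * odd_series s t
    = 2 * even_series s t + hconst (s + t) * (even_series s t * even_series s t)"
proof -
  let ?U = "odd_series s t" and ?V = "even_series s t"
  let ?J = "?U * ?U - (?V + ?V) - hconst (s + t) * (?V * ?V)"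
  \<comment> \<open>\<open>?J\<close> solves a homogeneous linear equation with initial value 0\<close>
  have "hderiv ?J = ((hconst s + hconst s) * ?U) * ?J"
    by (simp only: hderiv_mult hderiv_diff hderiv_add hderiv_hconst hderiv_odd_series
        hderiv_even_series hconst_add mult_zero_left add_0_left) (simp add: algebra_simps)
  then have "?J = 0"
    by (rule hurwitz_linear_ode_unique) simp
  then show ?thesis by (simp add: algebra_simps)
qed

text \<open>U is odd and V is even: in each convolution of the wrong total parity, one of the two
  factors already has an index of the wrong parity.\<close>

lemma parity_coeffs_vanish:
  "(even n \<longrightarrow> odd_coeff s t n = 0) \<and> (odd n \<longrightarrow> even_coeff s t n = 0)"
proof (induction n rule: less_induct)
  case (less n)
  show ?case
  proof (cases n)
    case (Suc m)
    have "(\<Sum>k\<le>m. of_nat (m choose k) * odd_coeff s t k * odd_coeff s t (m - k)) = 0" if "odd m"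
    proof (rule sum.neutral, safe)
      fix k assume "k \<le> m"
      then have "even k \<or> even (m - k)" using that by auto
      moreover have "k < n" "m - k < n" using \<open>k \<le> m\<close> Suc by auto
      ultimately show "of_nat (m choose k) * odd_coeff s t k * odd_coeff s t (m - k) = 0"
        using less by fastforce
    qed
    moreover have "(\<Sum>k\<le>m. of_nat (m choose k) * odd_coeff s t k * even_coeff s t (m - k)) = 0"
      if "even m"
    proof (rule sum.neutral, safe)
      fix k assume "k \<le> m"
      then have "even k \<or> odd (m - k)" using that by auto
      moreover have "k < n" "m - k < n" using \<open>k \<le> m\<close> Suc by auto
      ultimately show "of_nat (m choose k) * odd_coeff s t k * even_coeff s t (m - k) = 0"
        using less by fastforce
    qed
    ultimately show ?thesis using less[of m] Suc by (auto intro: odd_pos)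
  qed simp
qed

lemma odd_coeff_even [simp]: "even n \<Longrightarrow> odd_coeff s t n = 0"
  and even_coeff_odd [simp]: "odd n \<Longrightarrow> even_coeff s t n = 0"
  using parity_coeffs_vanish by auto

section \<open>Homogeneity\<close>

text \<open>
  \<open>homogeneous s t d p u\<close>: the value \<open>u\<close> is obtained from a homogeneous integer polynomial of degree
  \<open>d\<close> at \<open>(s, t)\<close>, and \<open>p\<close> is the value of the same polynomial at \<open>(X, 1)\<close>, which determines it.
\<close>

inductive homogeneous :: "'b::comm_ring_1 \<Rightarrow> 'b \<Rightarrow> nat \<Rightarrow> int poly \<Rightarrow> 'b \<Rightarrow> bool" for s t where
  zero: "homogeneous s t d 0 0"
| one: "homogeneous s t 0 1 1"
| add: "homogeneous s t d p u \<Longrightarrow> homogeneous s t d q v \<Longrightarrow> homogeneous s t d (p + q) (u + v)"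
| mult_s: "homogeneous s t d p u \<Longrightarrow> homogeneous s t (Suc d) ([:0, 1:] * p) (s * u)"
| mult_t: "homogeneous s t d p u \<Longrightarrow> homogeneous s t (Suc d) p (t * u)"

lemma homogeneous_mult:
  assumes "homogeneous s t d p u" "homogeneous s t e q v"
  shows "homogeneous s t (d + e) (p * q) (u * v)"
  using assms(1)
proof induction
  case (mult_s d p u)
  from homogeneous.mult_s[OF this(2)] show ?case by (simp only: mult.assoc add_Suc)
next
  case (mult_t d p u)
  from homogeneous.mult_t[OF this(2)] show ?case by (simp only: mult.assoc add_Suc)
qed (use assms(2) in \<open>auto intro: homogeneous.intros simp: distrib_right\<close>)

lemma homogeneous_of_nat_mult:
  "homogeneous s t d p u \<Longrightarrow> homogeneous s t d (of_nat k * p) (of_nat k * u)"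
  by (induction k) (auto intro: homogeneous.intros simp: distrib_right simp del: mult_pCons_left)

lemma homogeneous_sum:
  "finite I \<Longrightarrow> (\<And>i. i \<in> I \<Longrightarrow> homogeneous s t d (p i) (u i))
    \<Longrightarrow> homogeneous s t d (sum p I) (sum u I)"
  by (induction I rule: finite_induct) (auto intro: homogeneous.intros)

text \<open>The coefficient of \<open>p\<close> at X^j belongs to the monomial s^j t^(d-j). Hence a
  computation with integer polynomials determines the value in every commutative ring.\<close>

lemma homogeneous_expansion:
  assumes "homogeneous s t d p u"
  shows "u = (\<Sum>j=0..d. of_int (coeff p j) * s ^ j * t ^ (d - j))"
proof -
  \<comment> \<open>The degree bound is carried along so that coefficient \<open>Suc d\<close> of
    \<open>p\<close> vanishes in the case \<open>mult_t\<close>.\<close>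
  have "degree p \<le> d \<and> u = (\<Sum>j=0..d. of_int (coeff p j) * s ^ j * t ^ (d - j))"
    using assms
  proof induction
    case (add d p u q v)
    then show ?case by (simp add: sum.distrib distrib_right degree_add_le)
  next
    case (mult_s d p u)
    have "(\<Sum>j=0..Suc d. of_int (coeff ([:0, 1:] * p) j) * s ^ j * t ^ (Suc d - j))
        = s * (\<Sum>j=0..d. of_int (coeff p j) * s ^ j * t ^ (d - j))"
      by (subst sum.atLeast0_atMost_Suc_shift) (simp add: sum_distrib_left algebra_simps)
    then show ?case using mult_s by (simp add: le_trans[OF degree_pCons_le])
  next
    case (mult_t d p u)
    then have "coeff p (Suc d) = 0" by (simp add: coeff_eq_0)
    then have "(\<Sum>j=0..Suc d. of_int (coeff p j) * s ^ j * t ^ (Suc d - j))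
        = t * (\<Sum>j=0..d. of_int (coeff p j) * s ^ j * t ^ (d - j))"
      by (simp add: sum_distrib_left Suc_diff_le algebra_simps)
    then show ?case using mult_t by simp
  qed auto
  then show ?thesis ..
qed

text \<open>All summands of each recursion have the same degree. The truncation in
  \<open>n div 2 - 1\<close> is harmless for \<open>n \<le> 1\<close>, where the even coefficient is
  0 and thus homogeneous of any degree.\<close>

lemma homogeneous_coeffs:
  "homogeneous s t (n div 2) (odd_coeff [:0, 1:] 1 n) (odd_coeff s t n) \<and>
   homogeneous s t (n div 2 - 1) (even_coeff [:0, 1:] 1 n) (even_coeff s t n)"
proof (induction n rule: less_induct)
  case (less n)
  show ?case
  proof (cases n)
    case 0
    then show ?thesis by (auto intro: homogeneous.zero)
  next
    case (Suc m)
    have "homogeneous s t (n div 2) (odd_coeff [:0, 1:] 1 n) (odd_coeff s t n)"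
    proof (cases "even m")
      case False
      then show ?thesis using Suc by (auto intro: homogeneous.zero simp del: odd_coeff.simps)
    next
      case True
      have 1: "homogeneous s t (n div 2) (if m = 0 then 1 else 0) (if m = 0 then 1 else 0)"
        using Suc by (auto intro: homogeneous.intros)
      have 2: "homogeneous s t (n div 2) (even_coeff [:0, 1:] 1 m) (t * even_coeff s t m)"
      \<comment> \<open>At \<open>m = 0\<close> truncation breaks the degree count below, but the
        coefficient there is 0.\<close>
      proof (cases "m = 0")
        case True
        then show ?thesis by (auto intro: homogeneous.zero)
      next
        case False
        then have "n div 2 = Suc (m div 2 - 1)" using True Suc by (auto elim!: evenE)
        then show ?thesis using less[of m] Suc by (auto intro: homogeneous.mult_t)
      qed
      have 3: "homogeneous s t (n div 2)
          ([:0, 1:] * (\<Sum>k\<le>m. of_nat (m choose k) * odd_coeff [:0, 1:] 1 k * odd_coeff [:0, 1:] 1 (m - k)))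
          (s * (\<Sum>k\<le>m. of_nat (m choose k) * odd_coeff s t k * odd_coeff s t (m - k)))"
      proof (cases "m = 0")
        case True
        then show ?thesis by (auto intro: homogeneous.zero)
      next
        case False
        then have n: "n div 2 = Suc (m div 2 - 1)" using True Suc by (auto elim!: evenE)
        show ?thesis unfolding n
        proof (intro homogeneous.mult_s homogeneous_sum)
          fix k assume "k \<in> {..m}"
          then have k: "k < n" "m - k < n" using Suc by auto
          show "homogeneous s t (m div 2 - 1)
            (of_nat (m choose k) * odd_coeff [:0, 1:] 1 k * odd_coeff [:0, 1:] 1 (m - k))
            (of_nat (m choose k) * odd_coeff s t k * odd_coeff s t (m - k))"
          proof (cases "even k")
            case True
            then show ?thesis by (auto intro: homogeneous.zero)
          next
            case odd: False
            with \<open>even m\<close> \<open>k \<in> {..m}\<close> have "m div 2 - 1 = k div 2 + (m - k) div 2"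
              by (auto elim!: evenE oddE)
            from this less[OF k(1)] less[OF k(2)] show ?thesis
              by (auto simp only: intro!: homogeneous_mult homogeneous_of_nat_mult)
          qed
        qed simp
      qed
      show ?thesis unfolding Suc odd_coeff.simps mult_1
        using homogeneous.add[OF homogeneous.add[OF 1 2] 3] Suc by simp
    qed
    moreover have "homogeneous s t (n div 2 - 1) (even_coeff [:0, 1:] 1 n) (even_coeff s t n)"
    proof (cases "odd m")
      case False
      then show ?thesis using Suc by (auto intro: homogeneous.zero simp del: even_coeff.simps)
    next
      case True
      then have m: "n div 2 - 1 = m div 2" using Suc by (auto elim!: oddE)
      have 1: "homogeneous s t (n div 2 - 1) (odd_coeff [:0, 1:] 1 m) (odd_coeff s t m)"
        using less[of m] Suc m by auto
      have 2: "homogeneous s t (n div 2 - 1)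
          ([:0, 1:] * (\<Sum>k\<le>m. of_nat (m choose k) * odd_coeff [:0, 1:] 1 k * even_coeff [:0, 1:] 1 (m - k)))
          (s * (\<Sum>k\<le>m. of_nat (m choose k) * odd_coeff s t k * even_coeff s t (m - k)))"
      \<comment> \<open>At \<open>m = 1\<close> the truncated degrees do not fit, but both terms of
        the sum contain a vanishing coefficient.\<close>
      proof (cases "m = 1")
        case True
        then show ?thesis by (auto intro: homogeneous.zero)
      next
        case False
        then have n: "n div 2 - 1 = Suc (m div 2 - 1)" using True Suc by (auto elim!: oddE)
        show ?thesis unfolding n
        proof (intro homogeneous.mult_s homogeneous_sum)
          fix k assume "k \<in> {..m}"
          then have k: "k < n" "m - k < n" using Suc by auto
          show "homogeneous s t (m div 2 - 1)
            (of_nat (m choose k) * odd_coeff [:0, 1:] 1 k * even_coeff [:0, 1:] 1 (m - k))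
            (of_nat (m choose k) * odd_coeff s t k * even_coeff s t (m - k))"
          \<comment> \<open>For \<open>m = k\<close> the truncated degree of
            \<open>even_coeff s t 0\<close> would spoil the count, but this factor is 0.\<close>
          proof (cases "even k \<or> m = k")
            case True
            then show ?thesis by (auto intro: homogeneous.zero)
          next
            case odd: False
            with \<open>odd m\<close> \<open>k \<in> {..m}\<close> have "m div 2 - 1 = k div 2 + ((m - k) div 2 - 1)"
              by (auto elim!: oddE)
            from this less[OF k(1)] less[OF k(2)] show ?thesis
              by (auto simp only: intro!: homogeneous_mult homogeneous_of_nat_mult)
          qed
        qed simp
      qed
      show ?thesis unfolding Suc even_coeff.simps
        using homogeneous.add[OF 1 2] Suc by simp
    qed
    ultimately show ?thesis ..
  qed
qed

section \<open>Splitting permutations at the maximum\<close>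

text \<open>Exchanging \<open>(a, b)\<close> with \<open>(c, d)\<close> accounts for the change of parity of the positions in the tail.\<close>

fun word_weight :: "'a::comm_ring_1 \<Rightarrow> 'a \<Rightarrow> 'a \<Rightarrow> 'a \<Rightarrow> nat list \<Rightarrow> 'a" where
  "word_weight a b c d (x # y # l) = (if x > y then a else b) * word_weight c d a b (y # l)"
| "word_weight a b c d _ = 1"

lemma word_weight_Cons_max:
  "\<forall>x\<in>set r. x < M \<Longrightarrow>
    word_weight a b c d (M # r) = (if r = [] then 1 else a * word_weight c d a b r)"
  by (cases r) auto

text \<open>\<open>M\<close> is entered by an ascent at position \<open>length l\<close> and left by
  a descent at the next position. The parity of \<open>length l\<close> fixes both weights and
  decides whether the weights of the tail \<open>r\<close> are exchanged.\<close>

lemma word_weight_split_max: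
  assumes "\<forall>x\<in>set l \<union> set r. x < M"
  shows "word_weight a b c d (l @ M # r) =
    (if even (length l)
     then (if l = [] then 1 else d * word_weight a b c d l)
          * (if r = [] then 1 else a * word_weight c d a b r)
     else b * word_weight a b c d l * (if r = [] then 1 else c * word_weight a b c d r))"
  using assms
proof (induction a b c d l rule: word_weight.induct)
  case (1 a b c d x y l)
  have "\<forall>x\<in>set (y # l) \<union> set r. x < M"
    using 1(2) by auto
  from 1(1)[OF this] show ?case by (simp add: mult_ac)
qed (auto simp: word_weight_Cons_max order_less_not_sym mult_ac)

text \<open>Any set of letters is allowed, because the letters on either side of the maximum form
  arbitrary subsets.\<close>

definition weight_sum :: "'a::comm_ring_1 \<Rightarrow> 'a \<Rightarrow> 'a \<Rightarrow> 'a \<Rightarrow> nat set \<Rightarrow> 'a" where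
  "weight_sum a b c d S = (\<Sum>l\<in>permutations_of_set S. word_weight a b c d l)"

lemma weight_sum_empty [simp]: "weight_sum a b c d {} = 1"
  by (simp add: weight_sum_def)

lemma permutations_of_set_split_bij:
  assumes "M \<in> S"
  shows "bij_betw (\<lambda>(T, l, r). l @ M # r)
    (SIGMA T:Pow (S - {M}). permutations_of_set T \<times> permutations_of_set (S - {M} - T))
    (permutations_of_set S)"
proof (rule bij_betw_imageI)
  let ?D = "SIGMA T:Pow (S - {M}). permutations_of_set T \<times> permutations_of_set (S - {M} - T)"
  show "inj_on (\<lambda>(T, l, r). l @ M # r) ?D"
  proof (rule inj_onI, clarsimp)
    fix T l r T' l' r'
    assume *: "T \<subseteq> S - {M}" "T' \<subseteq> S - {M}" "l \<in> permutations_of_set T"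
      "l' \<in> permutations_of_set T'" "r \<in> permutations_of_set (S - {M} - T)"
      "r' \<in> permutations_of_set (S - {M} - T')" "l @ M # r = l' @ M # r'"
    \<comment> \<open>\<open>M\<close> occurs in neither \<open>l\<close> nor \<open>r\<close>, so
      the place of the cut is unique.\<close>
    then have "M \<notin> set l" "M \<notin> set r" "set l = T" "set l' = T'"
      by (auto dest: permutations_of_setD)
    with * show "T = T' \<and> l = l' \<and> r = r'"
      by (auto simp: append_Cons_eq_iff)
  qed
  show "(\<lambda>(T, l, r). l @ M # r) ` ?D = permutations_of_set S"
  proof (intro equalityI subsetI)
    fix w assume w: "w \<in> permutations_of_set S"
    then obtain l r where lr: "w = l @ M # r"
      using assms by (metis permutations_of_setD(1) split_list)
    have "set (l @ M # r) = S" "distinct (l @ M # r)"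
      using permutations_of_setD[OF w] lr by simp_all
    then have "(set l, l, r) \<in> ?D"
      by (auto intro!: permutations_of_setI)
    then show "w \<in> (\<lambda>(T, l, r). l @ M # r) ` ?D"
      unfolding lr by (rule rev_image_eqI) simp
  qed (use assms in \<open>auto simp: permutations_of_set_def\<close>)
qed

text \<open>Turns a sum over left letter sets into a binomial convolution, hence into a coefficient
  of a product of Hurwitz series.\<close>

lemma sum_Pow_card:
  fixes g :: "nat \<Rightarrow> 'a::comm_ring_1"
  assumes "finite S"
  shows "(\<Sum>T\<in>Pow S. g (card T)) = (\<Sum>k\<le>card S. of_nat (card S choose k) * g k)"
proof -
  have "(\<Sum>T\<in>Pow S. g (card T)) = (\<Sum>k\<le>card S. \<Sum>T | T \<in> Pow S \<and> card T = k. g (card T))"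
    using assms by (intro sum.group[symmetric]) (auto intro: card_mono)
  also have "\<dots> = (\<Sum>k\<le>card S. of_nat (card S choose k) * g k)"
    by (intro sum.cong) (auto simp: n_subsets[OF assms, symmetric])
  finally show ?thesis .
qed

lemma weight_sum_split_max:
  assumes "finite S" "M \<in> S" "\<forall>x\<in>S. x \<le> M"
  shows "weight_sum a b c d S = (\<Sum>T\<in>Pow (S - {M}).
    (if even (card T)
     then (if T = {} then 1 else d * weight_sum a b c d T)
          * (if S - {M} - T = {} then 1 else a * weight_sum c d a b (S - {M} - T))
     else b * weight_sum a b c d T
          * (if S - {M} - T = {} then 1 else c * weight_sum a b c d (S - {M} - T))))"
proof -
  let ?P = permutations_of_set
  have "weight_sum a b c d S =
      (\<Sum>z\<in>(SIGMA T:Pow (S - {M}). ?P T \<times> ?P (S - {M} - T)).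
        word_weight a b c d ((\<lambda>(T, l, r). l @ M # r) z))"
    unfolding weight_sum_def
    by (rule sum.reindex_bij_betw[OF permutations_of_set_split_bij[OF assms(2)], symmetric])
  also have "\<dots> = (\<Sum>T\<in>Pow (S - {M}). \<Sum>(l, r)\<in>?P T \<times> ?P (S - {M} - T).
        word_weight a b c d (l @ M # r))"
    using assms(1) by (subst sum.Sigma) (auto simp: split_beta)
  also have "\<dots> = (\<Sum>T\<in>Pow (S - {M}). \<Sum>l\<in>?P T. \<Sum>r\<in>?P (S - {M} - T).
        word_weight a b c d (l @ M # r))"
    by (simp add: sum.cartesian_product)
  also have "\<dots> = (\<Sum>T\<in>Pow (S - {M}).
    (if even (card T)
     then (if T = {} then 1 else d * weight_sum a b c d T)
          * (if S - {M} - T = {} then 1 else a * weight_sum c d a b (S - {M} - T))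
     else b * weight_sum a b c d T
          * (if S - {M} - T = {} then 1 else c * weight_sum a b c d (S - {M} - T))))"
    (is "_ = (\<Sum>T\<in>_. ?R T)")
  proof (rule sum.cong[OF refl])
    fix T assume T: "T \<in> Pow (S - {M})"
    define U where "U = S - {M} - T"
    have weight: "word_weight a b c d (l @ M # r) =
        (if even (card T)
         then (if T = {} then 1 else d * word_weight a b c d l)
              * (if U = {} then 1 else a * word_weight c d a b r)
         else b * word_weight a b c d l * (if U = {} then 1 else c * word_weight a b c d r))"
      if "l \<in> ?P T" "r \<in> ?P U" for l r
    proof -
      have lr: "set l = T" "set r = U" "length l = card T"
        using that by (auto dest: permutations_of_setD length_finite_permutations_of_set)
      then have "\<forall>x\<in>set l \<union> set r. x < M"
        using assms(3) T by (auto simp: U_def order.strict_iff_order)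
      moreover have "l = [] \<longleftrightarrow> T = {}" "r = [] \<longleftrightarrow> U = {}"
        using lr by auto
      ultimately show ?thesis
        by (simp only: word_weight_split_max lr(3))
    qed
    have "(\<Sum>l\<in>?P T. \<Sum>r\<in>?P U. word_weight a b c d (l @ M # r)) =
       (\<Sum>l\<in>?P T. \<Sum>r\<in>?P U. if even (card T)
         then (if T = {} then 1 else d * word_weight a b c d l)
              * (if U = {} then 1 else a * word_weight c d a b r)
         else b * word_weight a b c d l * (if U = {} then 1 else c * word_weight a b c d r))"
      by (intro sum.cong refl weight)
    also have "\<dots> = (if even (card T)
     then (if T = {} then 1 else d * weight_sum a b c d T)
          * (if U = {} then 1 else a * weight_sum c d a b U)
     else b * weight_sum a b c d T * (if U = {} then 1 else c * weight_sum a b c d U))"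
      \<comment> \<open>Once the emptiness tests are resolved, the double sum factors into two
        weight sums.\<close>
      by (cases "T = {}"; cases "U = {}")
         (simp_all add: weight_sum_def flip: sum_distrib_left sum_distrib_right)
    finally show "(\<Sum>l\<in>?P T. \<Sum>r\<in>?P (S - {M} - T). word_weight a b c d (l @ M # r)) = ?R T"
      unfolding U_def .
  qed
  finally show ?thesis .
qed

text \<open>The closed form to be established for all weights. Exchanging (a, b) with (c, d) fixes s
  and t, so both sides of the maximum involve the same U and V.\<close>

definition weight_series :: "'a::comm_ring_1 \<Rightarrow> 'a \<Rightarrow> 'a \<Rightarrow> 'a \<Rightarrow> 'a hurwitz" where
  "weight_series a b c d = 1 + odd_series (a * d + b * c) (a * c + b * d)
     + hconst (a + b) * even_series (a * d + b * c) (a * c + b * d)"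

text \<open>The two products mirror \<open>weight_sum_split_max\<close>: left parts of even length,
  then of odd length. The summands 1 account for empty parts, which an odd left part never
  is.\<close>

lemma hderiv_weight_series:
  fixes a b c d :: "'a::comm_ring_1"
  defines "s \<equiv> a * d + b * c" and "t \<equiv> a * c + b * d"
  shows "hderiv (weight_series a b c d) =
    (1 + hconst (d * (a + b)) * even_series s t)
      * (1 + hconst a * (odd_series s t + hconst (c + d) * even_series s t))
    + hconst b * odd_series s t
      * (1 + hconst c * (odd_series s t + hconst (a + b) * even_series s t))"
proof -
  define u v where "u = odd_series s t" and "v = even_series s t"
  define A B C D where "A = hconst a" and "B = hconst b" and "C = hconst c" and "D = hconst d"
  have st: "hconst s = A * D + B * C" "hconst t = A * C + B * D"
    by (simp_all add: s_def t_def hconst_add hconst_mult A_def B_def C_def D_def)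
  have "hderiv (weight_series a b c d) = hderiv u + (A + B) * hderiv v"
    by (simp add: weight_series_def u_def v_def s_def t_def A_def B_def hconst_add)
  also have "\<dots> = 1 + hconst t * v + (A * D + B * C) * (u * u) + (A + B) * (u + hconst s * (u * v))"
    by (simp add: u_def v_def hderiv_odd_series hderiv_even_series st)
  also have "\<dots> = 1 + hconst t * v + A * D * (u * u) + B * C * (u * u)
      + (A + B) * (u + hconst s * (u * v))"
    by (simp add: algebra_simps)
  \<comment> \<open>The first integral is applied to this term only; the other multiple of U^2
    already occurs in the target.\<close>
  also have "A * D * (u * u) = A * D * (v + v + (hconst s + hconst t) * (v * v))"
    by (simp add: u_def v_def odd_series_square hconst_add)
  also have "1 + hconst t * v + A * D * (v + v + (hconst s + hconst t) * (v * v)) + B * C * (u * u)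
      + (A + B) * (u + hconst s * (u * v)) =
    (1 + (D * (A + B)) * v) * (1 + A * (u + (C + D) * v)) + B * u * (1 + C * (u + (A + B) * v))"
    unfolding st by (simp add: algebra_simps)
  finally show ?thesis
    by (simp add: u_def v_def A_def B_def C_def D_def hconst_add hconst_mult)
qed

text \<open>Both sides satisfy the recursion given by splitting at the maximum. The weights stay
  arbitrary in the induction because tails may carry exchanged ones.\<close>

lemma weight_sum_eq_hnth:
  assumes "finite S"
  shows "weight_sum a b c d S = hnth (weight_series a b c d) (card S)"
  using assms
proof (induction "card S" arbitrary: S a b c d rule: less_induct)
  case less
  show ?case
  proof (cases "S = {}")
    case True
    then show ?thesis by (simp add: weight_series_def hnth_one)
  next
    case False
    define M where "M = Max S"
    have M: "M \<in> S" "\<forall>x\<in>S. x \<le> M"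
      using False less.prems by (auto simp: M_def)
    define n where "n = card (S - {M})"
    have cS: "card S = Suc n"
      using card_Suc_Diff1[OF less.prems M(1)] by (simp add: n_def)
    define s t where "s = a * d + b * c" and "t = a * c + b * d"
    \<comment> \<open>\<open>L1\<close> has only even and \<open>L2\<close> only odd coefficients,
      so at most one of the two products contributes for each \<open>T\<close>.\<close>
    define L1 where "L1 = 1 + hconst (d * (a + b)) * even_series s t"
    define R1 where "R1 = 1 + hconst a * (odd_series s t + hconst (c + d) * even_series s t)"
    define L2 where "L2 = hconst b * odd_series s t"
    define R2 where "R2 = 1 + hconst c * (odd_series s t + hconst (a + b) * even_series s t)"
    have st: "c * b + d * a = s" "c * a + d * b = t"
      by (simp_all add: s_def t_def algebra_simps)
    have "weight_sum a b c d S
        = (\<Sum>T\<in>Pow (S - {M}). hnth L1 (card T) * hnth R1 (n - card T)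
             + hnth L2 (card T) * hnth R2 (n - card T))"
      unfolding weight_sum_split_max[OF less.prems M]
    proof (rule sum.cong[OF refl])
      fix T assume T: "T \<in> Pow (S - {M})"
      define U where "U = S - {M} - T"
      have fin: "finite T" "finite U"
        using T less.prems by (auto simp: U_def intro: finite_subset)
      have cU: "card U = n - card T"
        using T fin by (simp add: U_def n_def card_Diff_subset)
      have "card T \<le> n"
        using T less.prems by (auto simp: n_def intro: card_mono)
      then have less': "card T < card S" "card U < card S"
        using cU cS by auto
      have T0: "T = {} \<longleftrightarrow> card T = 0" and U0: "U = {} \<longleftrightarrow> card U = 0"
        using fin by auto
      have IHT: "weight_sum a b c d T = hnth (weight_series a b c d) (card T)"
        and IHU: "weight_sum a b c d U = hnth (weight_series a b c d) (card U)"
        and IHU': "weight_sum c d a b U = hnth (weight_series c d a b) (card U)"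
        using less.hyps less' fin by blast+
      have "(if U = {} then 1 else a * weight_sum c d a b U) = hnth R1 (card U)"
        unfolding U0 IHU' weight_series_def st by (simp add: R1_def hnth_one)
      moreover have "(if U = {} then 1 else c * weight_sum a b c d U) = hnth R2 (card U)"
        unfolding U0 IHU weight_series_def s_def[symmetric] t_def[symmetric]
        by (simp add: R2_def hnth_one)
      moreover have "(if T = {} then 1 else d * weight_sum a b c d T) = hnth L1 (card T)"
          "hnth L2 (card T) = 0" if "even (card T)"
        unfolding T0 IHT weight_series_def s_def[symmetric] t_def[symmetric]
        using that by (simp_all add: L1_def L2_def hnth_one mult.assoc)
      moreover have "b * weight_sum a b c d T = hnth L2 (card T)" "hnth L1 (card T) = 0"
        if "odd (card T)"
        unfolding IHT weight_series_def s_def[symmetric] t_def[symmetric]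
        using that odd_pos[OF that] by (simp_all add: L1_def L2_def hnth_one)
      ultimately show "(if even (card T)
         then (if T = {} then 1 else d * weight_sum a b c d T)
              * (if S - {M} - T = {} then 1 else a * weight_sum c d a b (S - {M} - T))
         else b * weight_sum a b c d T
              * (if S - {M} - T = {} then 1 else c * weight_sum a b c d (S - {M} - T)))
        = hnth L1 (card T) * hnth R1 (n - card T) + hnth L2 (card T) * hnth R2 (n - card T)"
        unfolding U_def[symmetric] cU[symmetric] by simp
    qed
    also have "\<dots> = (\<Sum>k\<le>n. of_nat (n choose k)
        * (hnth L1 k * hnth R1 (n - k) + hnth L2 k * hnth R2 (n - k)))"
      unfolding n_def using less.prems by (subst sum_Pow_card) simp_all
    also have "\<dots> = hnth (L1 * R1 + L2 * R2) n"
      by (simp add: hnth_mult sum.distrib distrib_left mult.assoc)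
    also have "L1 * R1 + L2 * R2 = hderiv (weight_series a b c d)"
      by (simp only: L1_def R1_def L2_def R2_def hderiv_weight_series s_def t_def)
    finally show ?thesis by (simp add: cS hnth_hderiv)
  qed
qed

section \<open>From words to permutations and their statistics\<close>

text \<open>List indices start at 0, so the odd positions of a permutation are the even indices.\<close>

lemma word_weight_nth:
  "word_weight a b c d l = (\<Prod>i<length l - 1.
     if even i then (if l ! i > l ! Suc i then a else b) else (if l ! i > l ! Suc i then c else d))"
proof (induction a b c d l rule: word_weight.induct)
  case (1 a b c d x y l)
  then show ?case
    by (auto simp: prod.lessThan_Suc_shift simp del: prod.lessThan_Suc
        intro!: arg_cong2[where f = "(*)"] prod.cong)
qed simp_all

lemma prod_choice_power:
  fixes a b :: "'a::comm_monoid_mult"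
  assumes "finite I"
  shows "(\<Prod>i\<in>I. if P i then a else b) = a ^ card {i\<in>I. P i} * b ^ card {i\<in>I. \<not> P i}"
  using assms by (simp add: prod.If_cases Int_def)

text \<open>The fourth statistic, serving as exponent of the weight b.\<close>

definition asc1 :: "nat \<Rightarrow> (nat \<Rightarrow> nat) \<Rightarrow> nat" where
  "asc1 n \<sigma> = card {i \<in> {1..<n}. odd i \<and> \<sigma> i < \<sigma> (i + 1)}"

lemma word_weight_permutation:
  assumes \<sigma>: "\<sigma> permutes {1..n}"
  shows "word_weight a b c d (map \<sigma> [1..<Suc n])
    = a ^ des1 n \<sigma> * b ^ asc1 n \<sigma> * c ^ des0 n \<sigma> * d ^ asc0 n \<sigma>"
proof -
  \<comment> \<open>Neighbouring values differ, so a position that is no descent is an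
    ascent.\<close>
  have ne: "\<sigma> i \<noteq> \<sigma> (i + 1)" for i
    using permutes_inj[OF \<sigma>] by (metis add_cancel_left_right injD one_neq_zero)
  let ?w = "\<lambda>i. if odd i then (if \<sigma> i > \<sigma> (i + 1) then a else b)
      else (if \<sigma> i > \<sigma> (i + 1) then c else d)"
  have "word_weight a b c d (map \<sigma> [1..<Suc n]) = (\<Prod>i<n - 1. ?w (Suc i))"
    unfolding word_weight_nth by (intro prod.cong) (auto simp del: upt_Suc)
  also have "\<dots> = prod ?w {1..<n}"
    by (rule prod.reindex_bij_witness[of _ "\<lambda>i. i - 1" Suc]) auto
  also have "\<dots> = prod ?w ({i\<in>{1..<n}. odd i} \<union> {i\<in>{1..<n}. even i})"
    by (rule prod.cong) auto
  also have "\<dots> = prod ?w {i\<in>{1..<n}. odd i} * prod ?w {i\<in>{1..<n}. even i}"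
    by (rule prod.union_disjoint) auto
  also have "prod ?w {i\<in>{1..<n}. odd i}
      = (\<Prod>i | i\<in>{1..<n} \<and> odd i. if \<sigma> i > \<sigma> (i + 1) then a else b)"
    by (rule prod.cong) auto
  also have "\<dots> = a ^ des1 n \<sigma> * b ^ asc1 n \<sigma>"
    using ne by (subst prod_choice_power)
      (auto simp: des1_def asc1_def not_less order.order_iff_strict conj_assoc)
  also have "prod ?w {i\<in>{1..<n}. even i}
      = (\<Prod>i | i\<in>{1..<n} \<and> even i. if \<sigma> i > \<sigma> (i + 1) then c else d)"
    by (rule prod.cong) auto
  also have "\<dots> = c ^ des0 n \<sigma> * d ^ asc0 n \<sigma>"
    using ne by (subst prod_choice_power)
      (auto simp: des0_def asc0_def not_less order.order_iff_strict conj_assoc)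
  finally show ?thesis by (simp add: mult.assoc)
qed

lemma bij_betw_permutes_words:
  "bij_betw (\<lambda>\<sigma>. map \<sigma> [1..<Suc n]) {\<sigma>. \<sigma> permutes {1..n}} (permutations_of_set {1..n})"
proof (rule bij_betw_imageI)
  show inj: "inj_on (\<lambda>\<sigma>. map \<sigma> [1..<Suc n]) {\<sigma>. \<sigma> permutes {1..n}}"
  proof (rule inj_onI, rule ext)
    fix \<sigma> \<tau> x
    assume *: "\<sigma> \<in> {\<sigma>. \<sigma> permutes {1..n}}" "\<tau> \<in> {\<sigma>. \<sigma> permutes {1..n}}"
      "map \<sigma> [1..<Suc n] = map \<tau> [1..<Suc n]"
    then show "\<sigma> x = \<tau> x"
      by (cases "x \<in> {1..n}") (auto simp: permutes_not_in simp del: upt_Suc)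
  qed
  have "(\<lambda>\<sigma>. map \<sigma> [1..<Suc n]) ` {\<sigma>. \<sigma> permutes {1..n}} \<subseteq> permutations_of_set {1..n}"
  proof clarify
    fix \<sigma> assume \<sigma>: "\<sigma> permutes {1..n}"
    have "set (map \<sigma> [1..<Suc n]) = \<sigma> ` {1..n}"
      by (simp add: atLeastLessThanSuc_atLeastAtMost del: upt_Suc)
    then show "map \<sigma> [1..<Suc n] \<in> permutations_of_set {1..n}"
      using \<sigma> by (intro permutations_of_setI)
        (simp_all add: permutes_image distinct_map permutes_inj_on del: upt_Suc)
  qed
  \<comment> \<open>An inclusion between finite sets of the same size n! is an equality.\<close>
  then show "(\<lambda>\<sigma>. map \<sigma> [1..<Suc n]) ` {\<sigma>. \<sigma> permutes {1..n}} = permutations_of_set {1..n}"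
    by (intro card_subset_eq) (simp_all add: card_image[OF inj] card_permutations[OF refl]
        del: upt_Suc One_nat_def)
qed

lemma sum_permutations_weight:
  assumes "n \<ge> 1"
  shows "(\<Sum>\<sigma> | \<sigma> permutes {1..n}. a ^ des1 n \<sigma> * b ^ asc1 n \<sigma> * c ^ des0 n \<sigma> * d ^ asc0 n \<sigma>)
    = odd_coeff (a * d + b * c) (a * c + b * d) n
      + (a + b) * even_coeff (a * d + b * c) (a * c + b * d) n"
proof -
  have "(\<Sum>\<sigma> | \<sigma> permutes {1..n}. a ^ des1 n \<sigma> * b ^ asc1 n \<sigma> * c ^ des0 n \<sigma> * d ^ asc0 n \<sigma>)
      = (\<Sum>\<sigma> | \<sigma> permutes {1..n}. word_weight a b c d (map \<sigma> [1..<Suc n]))"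
    by (rule sum.cong) (simp_all only: mem_Collect_eq word_weight_permutation)
  also have "\<dots> = weight_sum a b c d {1..n}"
    unfolding weight_sum_def by (rule sum.reindex_bij_betw[OF bij_betw_permutes_words])
  also have "\<dots> = hnth (weight_series a b c d) n"
    by (simp add: weight_sum_eq_hnth)
  finally show ?thesis
    using assms by (simp add: weight_series_def hnth_one)
qed

section \<open>The expansions\<close>

text \<open>In both specializations s + t = (1 + x)(1 + y), so the extra factor 1 + y for even n
  completes the factor a + b = x + 1.\<close>

definition gamma_form :: "nat \<Rightarrow> 'a::comm_ring_1 \<Rightarrow> 'a \<Rightarrow> 'a" where
  "gamma_form n s t = odd_coeff s t n + (s + t) * even_coeff s t n"

lemma A_tilde_eq_gamma_form:
  assumes "n \<ge> 1"
  shows "A_tilde n x y = gamma_form n (x + y) (1 + x * y)"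
proof -
  define p q where "p = odd_coeff (x + y) (1 + x * y) n" and "q = even_coeff (x + y) (1 + x * y) n"
  have "A_poly n x y = p + (x + 1) * q"
    using sum_permutations_weight[OF assms, of x 1 y 1]
    by (simp add: A_poly_def p_def q_def add.commute[of "x * y"])
  moreover have "gamma_form n (x + y) (1 + x * y) = p + (x + y + (1 + x * y)) * q"
    by (simp only: gamma_form_def p_def q_def)
  moreover have "even n \<Longrightarrow> p = 0" "odd n \<Longrightarrow> q = 0"
    by (simp_all add: p_def q_def)
  ultimately show ?thesis by (cases "even n") (simp_all add: A_tilde_def algebra_simps)
qed

lemma A_bar_eq_gamma_form:
  assumes "n \<ge> 1"
  shows "A_bar n x y = gamma_form n (1 + x * y) (x + y)"
proof -
  define p q where "p = odd_coeff (1 + x * y) (x + y) n" and "q = even_coeff (1 + x * y) (x + y) n"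
  have "A_hat n x y = p + (x + 1) * q"
    using sum_permutations_weight[OF assms, of x 1 1 y]
    by (simp add: A_hat_def p_def q_def add.commute[of "x * y"])
  moreover have "gamma_form n (1 + x * y) (x + y) = p + (1 + x * y + (x + y)) * q"
    by (simp only: gamma_form_def p_def q_def)
  moreover have "even n \<Longrightarrow> p = 0" "odd n \<Longrightarrow> q = 0"
    by (simp_all add: p_def q_def)
  ultimately show ?thesis by (cases "even n") (simp_all add: A_bar_def algebra_simps)
qed

text \<open>The factor s + t raises the degree of the even coefficient by one, to that of the odd
  coefficient.\<close>

lemma homogeneous_gamma_form:
  "homogeneous s t (n div 2) (gamma_form n [:0, 1:] 1) (gamma_form n s t)"
proof -
  have "homogeneous s t (n div 2)
      (([:0, 1:] + 1) * even_coeff [:0, 1:] 1 n) ((s + t) * even_coeff s t n)"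
  proof (cases "n div 2 = 0 \<or> odd n")
    case True
    then have "n = 0 \<or> odd n" by presburger
    then show ?thesis by (auto intro: homogeneous.zero)
  next
    case False
    have "homogeneous s t (Suc 0) ([:0, 1:] * 1 + 1) (s * 1 + t * 1)"
      by (intro homogeneous.intros)
    with homogeneous_coeffs[of s t n]
    have "homogeneous s t (Suc 0 + (n div 2 - 1))
        (([:0, 1:] * 1 + 1) * even_coeff [:0, 1:] 1 n) ((s * 1 + t * 1) * even_coeff s t n)"
      by (intro homogeneous_mult) auto
    moreover have "Suc 0 + (n div 2 - 1) = n div 2" using False by linarith
    ultimately show ?thesis by simp
  qed
  with homogeneous_coeffs[of s t n] show ?thesis
    unfolding gamma_form_def by (intro homogeneous.add) auto
qed

section \<open>Specialization at y = 0 and identification of the coefficients\<close>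

lemma des1_le: "des1 n \<sigma> \<le> n div 2"
proof -
  have "des1 n \<sigma> \<le> card ((\<lambda>k. 2 * k + 1) ` {..<n div 2})"
    unfolding des1_def by (rule card_mono) (auto elim!: oddE)
  also have "\<dots> \<le> n div 2"
    using card_image_le[of "{..<n div 2}" "\<lambda>k. 2 * k + 1"] by simp
  finally show ?thesis .
qed

text \<open>As \<open>0 ^ 0 = 1\<close>, the power of 0 selects the permutations with
  \<open>f \<sigma> = 0\<close>. Here \<open>f\<close> stands for \<open>des0 n\<close> or
  \<open>asc0 n\<close>.\<close>

lemma sum_statistic_at_zero:
  fixes x :: "'a::comm_ring_1"
  shows "(\<Sum>\<sigma> | \<sigma> permutes {1..n}. x ^ des1 n \<sigma> * 0 ^ f \<sigma>) =
    (\<Sum>j=0..n div 2. of_nat (card {\<sigma>. \<sigma> permutes {1..n} \<and> des1 n \<sigma> = j \<and> f \<sigma> = 0}) * x ^ j)"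
proof -
  let ?P = "{\<sigma>. \<sigma> permutes {1..n}}"
  have fin: "finite ?P" by (simp add: finite_permutations)
  have "(\<Sum>\<sigma>\<in>?P. x ^ des1 n \<sigma> * 0 ^ f \<sigma>) = (\<Sum>\<sigma>\<in>{\<sigma>\<in>?P. f \<sigma> = 0}. x ^ des1 n \<sigma>)"
    using fin by (intro sum.mono_neutral_cong_right) (auto simp: power_0_left split: if_splits)
  also have "\<dots> = (\<Sum>j=0..n div 2. \<Sum>\<sigma> | \<sigma> \<in> {\<sigma>\<in>?P. f \<sigma> = 0} \<and> des1 n \<sigma> = j. x ^ des1 n \<sigma>)"
    using fin des1_le by (intro sum.group[symmetric]) auto
  also have "\<dots> = (\<Sum>j=0..n div 2.
      of_nat (card {\<sigma>. \<sigma> permutes {1..n} \<and> des1 n \<sigma> = j \<and> f \<sigma> = 0}) * x ^ j)"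
    by (intro sum.cong refl) (simp add: conj_ac)
  finally show ?thesis .
qed

lemma A_poly_0: "A_poly n x 0 = (\<Sum>j=0..n div 2. of_nat (a_num n j) * x ^ j)"
  unfolding A_poly_def a_num_def by (rule sum_statistic_at_zero)

lemma A_hat_0: "A_hat n x 0 = (\<Sum>j=0..n div 2. of_nat (a_bar_num n j) * x ^ j)"
  unfolding A_hat_def a_bar_num_def by (rule sum_statistic_at_zero)

lemma coeff_sum_pX_powers:
  assumes "j \<le> m"
  shows "coeff (\<Sum>i=0..m. of_nat (g i) * [:0, 1:] ^ i) j = (of_nat (g j) :: int)"
proof -
  have "coeff (\<Sum>i=0..m. of_nat (g i) * [:0, 1:] ^ i) j
      = (\<Sum>i=0..m. if i = j then of_nat (g i) else (0 :: int))"
    by (simp add: coeff_sum of_nat_poly flip: monom_altdef)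
  then show ?thesis using assms by simp
qed

text \<open>At x = X, y = 0 over the integer polynomials, (s, t) is (X, 1) and the factor 1 + y is
  1. The coefficients read off there carry over to all s and t by homogeneity.\<close>

lemma gamma_form_expansion:
  assumes "n \<ge> 1"
  shows "gamma_form n s t = (\<Sum>j=0..n div 2. of_nat (a_num n j) * s ^ j * t ^ (n div 2 - j))"
proof -
  have "gamma_form n [:0, 1:] 1 = A_tilde n [:0, 1:] (0 :: int poly)"
    using assms by (simp add: A_tilde_eq_gamma_form)
  also have "\<dots> = (\<Sum>j=0..n div 2. of_nat (a_num n j) * [:0, 1:] ^ j)"
    by (simp add: A_tilde_def A_poly_0)
  finally have *: "gamma_form n [:0, 1:] 1
      = (\<Sum>j=0..n div 2. of_nat (a_num n j) * [:0, 1 :: int:] ^ j)" .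
  have "gamma_form n s t
      = (\<Sum>j=0..n div 2. of_int (coeff (gamma_form n [:0, 1:] 1) j) * s ^ j * t ^ (n div 2 - j))"
    by (rule homogeneous_expansion) (rule homogeneous_gamma_form)
  also have "\<dots> = (\<Sum>j=0..n div 2. of_nat (a_num n j) * s ^ j * t ^ (n div 2 - j))"
    unfolding * by (intro sum.cong refl) (simp add: coeff_sum_pX_powers del: of_nat_poly)
  finally show ?thesis .
qed

text \<open>\<open>A_bar\<close> is the same form with s and t exchanged, so at (X, 0) it is
  evaluated at (1, X), which reverses the coefficients.\<close>

lemma a_bar_num_eq:
  assumes "n \<ge> 1" "j \<le> n div 2"
  shows "a_bar_num n j = a_num n (n div 2 - j)"
proof -
  have "(\<Sum>j=0..n div 2. of_nat (a_bar_num n j) * [:0, 1 :: int:] ^ j) = A_bar n [:0, 1:] 0"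
    by (simp add: A_bar_def A_hat_0)
  also have "\<dots> = (\<Sum>j=0..n div 2. of_nat (a_num n j) * [:0, 1:] ^ (n div 2 - j))"
    using assms by (simp add: A_bar_eq_gamma_form gamma_form_expansion)
  also have "\<dots> = (\<Sum>j=0..n div 2. of_nat (a_num n (n div 2 - j)) * [:0, 1:] ^ j)"
    by (rule sum.reindex_bij_witness[of _ "\<lambda>j. n div 2 - j" "\<lambda>j. n div 2 - j"]) auto
  finally have "coeff (\<Sum>j=0..n div 2. of_nat (a_bar_num n j) * [:0, 1 :: int:] ^ j) j
      = coeff (\<Sum>j=0..n div 2. of_nat (a_num n (n div 2 - j)) * [:0, 1:] ^ j) j"
    by (rule arg_cong)
  then show ?thesis
    by (simp only: coeff_sum_pX_powers[OF assms(2)] of_nat_eq_iff)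
qed

theorem theorem2p5:
  fixes n :: nat and x y :: "'a::comm_ring_1"
  assumes "n \<ge> 1"
  shows "A_poly n x 0 = (\<Sum>j=0..n div 2. of_nat (a_num n j) * x ^ j) \<and>
    A_hat n x 0 = (\<Sum>j=0..n div 2. of_nat (a_bar_num n j) * x ^ j) \<and>
    A_tilde n x y =
      (\<Sum>j=0..n div 2. of_nat (a_num n j) * (x + y) ^ j * (1 + x * y) ^ (n div 2 - j)) \<and>
    A_bar n x y =
      (\<Sum>j=0..n div 2. of_nat (a_bar_num n j) * (x + y) ^ j * (1 + x * y) ^ (n div 2 - j)) \<and>
    (\<forall>j\<in>{0..n div 2}. a_bar_num n j = a_num n (n div 2 - j))"
proof -
  have "A_bar n x y
      = (\<Sum>j=0..n div 2. of_nat (a_num n j) * (1 + x * y) ^ j * (x + y) ^ (n div 2 - j))"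
    using assms by (simp add: A_bar_eq_gamma_form gamma_form_expansion)
  \<comment> \<open>Reversing the summation restores the order of the two powers and turns
    \<open>a_num\<close> into \<open>a_bar_num\<close>.\<close>
  also have "\<dots> = (\<Sum>j=0..n div 2.
      of_nat (a_bar_num n j) * (x + y) ^ j * (1 + x * y) ^ (n div 2 - j))"
    by (rule sum.reindex_bij_witness[of _ "\<lambda>j. n div 2 - j" "\<lambda>j. n div 2 - j"])
       (auto simp: a_bar_num_eq[OF assms] mult_ac)
  finally show ?thesis
    using assms
    by (simp add: A_poly_0 A_hat_0 A_tilde_eq_gamma_form gamma_form_expansion a_bar_num_eq)
qed

end
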